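(* Let $P=(P_{i,j})_{i,j\ge 0}$ be the array of integers defined by the initial values $P_{i,0}=-1$ for all $i\ge 0$, $P_{0,j}=0$ for all $j\ge 1$, and the recursion $P_{i,j}=2P_{i-1,j}-P_{i-1,j-1}$ for all $i\ge 1$, $j\ge 1$. For an integer $k\ge 2$, let $(F^{(k)}_n)_{n\in\mathbb{Z}}$ be the doubly infinite sequence determined by the initial values $F^{(k)}_i=0$ for $0\le i\le k-2$, $F^{(k)}_{k-1}=1$, and the recursion $F^{(k)}_n=\sum_{i=1}^{k}F^{(k)}_{n-i}$ for all integers $n$ (used forwards to define terms with index $\ge k$ and backwards to define terms with negative index). Then for every $k\ge 2$ and every integer $n$, $$F^{(k)}_n=\sum_{i=1}^{k}P_{k,i}\,F^{(k)}_{n-ki}.$$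
   Context: For example, the rows $i=2,3,4$ of $P$ (columns $j=1,\dots,i$) are $(3,-1)$, $(7,-5,1)$, $(15,-17,7,-1)$, giving $F_n=3F_{n-2}-F_{n-4}$ for the Fibonacci numbers ($k=2$), $F^{(3)}_n=7F^{(3)}_{n-3}-5F^{(3)}_{n-6}+F^{(3)}_{n-9}$ for the Tribonacci numbers, etc. *)

theory Defs
  imports Main
begin

fun P :: "nat \<Rightarrow> nat \<Rightarrow> int" where
  "P i 0 = -1"
| "P 0 (Suc j) = 0"
| "P (Suc i) (Suc j) = 2 * P i (Suc j) - P i j"

text \<open>
  For negative indices the recursion
  \<open>F n = (\<Sum>i = 1..k. F (n - i))\<close>, taken at \<open>n + k\<close>, is solved for its last
  summand \<open>F n\<close>. The value \<open>0\<close> for \<open>k < 2\<close> is a dummy.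
\<close>

context
  notes sum.cong [fundef_cong]
begin

function kfib :: "nat \<Rightarrow> int \<Rightarrow> int" where
  "kfib k n =
    (if k < 2 then 0
     else if 0 \<le> n \<and> n \<le> int k - 2 then 0
     else if n = int k - 1 then 1
     else if n \<ge> int k then (\<Sum>i = 1..k. kfib k (n - int i))
     else kfib k (n + int k) - (\<Sum>i = 1..k - 1. kfib k (n + int k - int i)))"
  by pat_completeness auto
termination
  by (relation "measure (\<lambda>(k, n). if 0 \<le> n \<and> n < int k then 0 else nat \<bar>n\<bar>)") auto

end

declare kfib.simps [simp del]

lemma kfib_init_zero: "k \<ge> 2 \<Longrightarrow> 0 \<le> n \<Longrightarrow> n \<le> int k - 2 \<Longrightarrow> kfib k n = 0"
  by (subst kfib.simps) simp

lemma kfib_init_one: "k \<ge> 2 \<Longrightarrow> kfib k (int k - 1) = 1"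
  by (subst kfib.simps) simp

lemma kfib_rec:
  fixes k :: nat and n :: int
  assumes k: "k \<ge> 2"
  shows "kfib k n = (\<Sum>i = 1..k. kfib k (n - int i))"
proof (cases "n \<ge> int k")
  case True
  then show ?thesis using k by (subst kfib.simps) simp
next
  case False
  have "{1..k} = insert k {1..k - 1}" using k by auto
  then have "(\<Sum>i = 1..k. kfib k (n - int i))
      = kfib k (n - int k) + (\<Sum>i = 1..k - 1. kfib k (n - int i))"
    using k by simp
  moreover have "kfib k (n - int k) = kfib k n - (\<Sum>i = 1..k - 1. kfib k (n - int i))"
    using False k by (subst kfib.simps) simp
  ultimately show ?thesis by simp
qed

lemma kfib_unique:
  fixes F :: "int \<Rightarrow> int"
  assumes k: "k \<ge> 2"
    and zero: "\<And>n. 0 \<le> n \<Longrightarrow> n \<le> int k - 2 \<Longrightarrow> F n = 0"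
    and one: "F (int k - 1) = 1"
    and rec: "\<And>n. F n = (\<Sum>i = 1..k. F (n - int i))"
  shows "F n = kfib k n"
proof (induction "if 0 \<le> n \<and> n < int k then 0 else nat \<bar>n\<bar>" arbitrary: n rule: less_induct)
  case less
  have IH: "F m = kfib k m"
    if "(if 0 \<le> m \<and> m < int k then 0 else nat \<bar>m\<bar>)
      < (if 0 \<le> n \<and> n < int k then 0 else nat \<bar>n\<bar>)" for m
    by (rule less) (rule that)
  have ins: "{1..k} = insert k {1..k - 1}" using k by auto
  consider "0 \<le> n \<and> n \<le> int k - 2" | "n = int k - 1" | "n \<ge> int k" | "n < 0" by linarith
  then show ?case
  proof cases
    case 1
    then show ?thesis using k zero[of n] by (simp add: kfib_init_zero)
  next
    case 2
    then show ?thesis using k one by (simp add: kfib_init_one)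
  next
    case 3
    have "F (n - int i) = kfib k (n - int i)" if "i \<in> {1..k}" for i
      by (rule IH) (use 3 that k in auto)
    then have "(\<Sum>i = 1..k. F (n - int i)) = (\<Sum>i = 1..k. kfib k (n - int i))"
      by (rule sum.cong[OF refl])
    with rec[of n] kfib_rec[OF k, of n] show ?thesis by metis
  next
    case 4
    have a: "F (n + int k) = kfib k (n + int k)"
      by (rule IH) (use 4 k in auto)
    have b: "F (n + int k - int i) = kfib k (n + int k - int i)" if "i \<in> {1..k - 1}" for i
      by (rule IH) (use 4 that k in auto)
    have b': "(\<Sum>i = 1..k - 1. F (n + int k - int i)) = (\<Sum>i = 1..k - 1. kfib k (n + int k - int i))"
      by (rule sum.cong[OF refl b])
    have split: "(\<Sum>i = 1..k. G (n + int k - int i)) = G n + (\<Sum>i = 1..k - 1. G (n + int k - int i))"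
      for G :: "int \<Rightarrow> int"
      by (subst ins) (use k in simp)
    show ?thesis
      using a b' split[of F] split[of "kfib k"] rec[of "n + int k"] kfib_rec[OF k, of "n + int k"]
      by linarith
  qed
qed

end

theory Submission imports Defs begin

text \<open>
  Let \<open>S\<close> be the shift \<open>(S f) n = f (n - 1)\<close>, \<open>F = kfib k\<close>, and \<open>Q i = (\<Sum>j. P i j * x ^ j)\<close>.
  The recursion of \<open>P\<close> reads \<open>Q (i + 1) = (2 - x) * Q i + 1\<close>, so
  \<open>(x - 1) * Q i = 1 - x * (2 - x) ^ i\<close>. Put \<open>x = S ^ k\<close>. Subtracting two consecutive instances
  of the \<open>k\<close>-step recursion gives \<open>S (2 - S ^ k) F = F\<close>, so \<open>(2 - x) ^ k F = S ^ (-k) F\<close> and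
  \<open>(x - 1) (Q k F) = 0\<close>: the sequence \<open>Q k F\<close> has period \<open>k\<close>. It also satisfies the \<open>k\<close>-step
  recursion, so each of its terms is the sum over a full period. It is therefore a constant \<open>c\<close>
  with \<open>c = k * c\<close>, that is, \<open>c = 0\<close>.
\<close>

lemma P_eq_0: "i < j \<Longrightarrow> P i j = 0"
  by (induction i j rule: P.induct) auto

text \<open>This is \<open>Q i\<close> at \<open>x = S ^ k\<close>, applied to
  \<open>F\<close>.\<close>

definition P_conv :: "nat \<Rightarrow> (int \<Rightarrow> int) \<Rightarrow> nat \<Rightarrow> int \<Rightarrow> int" where
  "P_conv k F i n = (\<Sum>j\<le>i. P i j * F (n - int k * int j))"

lemma P_conv_0: "P_conv k F 0 n = - F n"
  by (simp add: P_conv_def)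

lemma P_conv_Suc:
  "P_conv k F (Suc i) n = 2 * P_conv k F i n - P_conv k F i (n - int k) + F n"
proof -
  have shift: "(\<Sum>j\<le>i. P i (Suc j) * F (n - int k * int (Suc j))) = P_conv k F i n + F n"
  proof -
    \<comment> \<open>The added term is zero by \<open>P_eq_0\<close>; the term
      \<open>j = 0\<close>, split off next, is \<open>- F n\<close>.\<close>
    have "(\<Sum>j\<le>Suc i. P i j * F (n - int k * int j)) = P_conv k F i n"
      by (simp add: P_conv_def P_eq_0)
    then show ?thesis
      by (simp only: sum.atMost_Suc_shift) simp
  qed
  have "P_conv k F (Suc i) n
      = - F n + (\<Sum>j\<le>i. 2 * (P i (Suc j) * F (n - int k * int (Suc j)))
          - P i j * F (n - int k - int k * int j))"
    unfolding P_conv_def by (simp only: sum.atMost_Suc_shift) (simp add: algebra_simps)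
  also have "\<dots> = - F n + 2 * (P_conv k F i n + F n) - P_conv k F i (n - int k)"
    unfolding shift[symmetric] by (simp add: P_conv_def sum_subtractf sum_distrib_left)
  finally show ?thesis by simp
qed

lemma kstep_two_term:
  fixes F :: "int \<Rightarrow> int"
  assumes rec: "\<And>n. F n = (\<Sum>i = 1..k. F (n - int i))"
  shows "F (n + 1) = 2 * F n - F (n - int k)"
proof -
  \<comment> \<open>The window from \<open>n - int k\<close> to \<open>n\<close> is split at its
    lower end here, at its upper end below.\<close>
  have "F (n + 1) + F (n - int k) = (\<Sum>i\<le>k. F (n - int i))"
  proof -
    have "(\<Sum>i = 1..k. F (n + 1 - int i)) = (\<Sum>i<k. F (n - int i))"
      by (rule sum.reindex_bij_witness[of _ Suc "\<lambda>i. i - 1"]) (auto simp: algebra_simps)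
    then show ?thesis
      by (subst rec) (simp flip: lessThan_Suc_atMost)
  qed
  also have "\<dots> = F n + (\<Sum>i = 1..k. F (n - int i))"
    by (simp add: atMost_atLeast0 sum.atLeast_Suc_atMost)
  also have "\<dots> = 2 * F n"
    using rec[of n] by linarith
  finally show ?thesis by simp
qed

text \<open>By \<open>two\<close>, each factor \<open>2 - x\<close> in
  \<open>x * (2 - x) ^ i\<close> moves \<open>F\<close> forward by one.\<close>

lemma P_conv_shift_diff:
  fixes F :: "int \<Rightarrow> int"
  assumes two: "\<And>n. F (n + 1) = 2 * F n - F (n - int k)"
  shows "P_conv k F i (n - int k) - P_conv k F i n = F n - F (n - int k + int i)"
proof (induction i arbitrary: n)
  case 0
  then show ?case by (simp add: P_conv_0)
next
  case (Suc i)
  have "F (n - int k + int i + 1) = 2 * F (n - int k + int i) - F (n - int k + int i - int k)"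
    by (rule two)
  then show ?case
    using Suc[of n] Suc[of "n - int k"] by (simp add: P_conv_Suc algebra_simps)
qed

lemma P_conv_kstep:
  fixes F :: "int \<Rightarrow> int"
  assumes rec: "\<And>n. F n = (\<Sum>i = 1..k. F (n - int i))"
  shows "P_conv k F m n = (\<Sum>i = 1..k. P_conv k F m (n - int i))"
proof -
  have "P_conv k F m n = (\<Sum>j\<le>m. \<Sum>i = 1..k. P m j * F (n - int k * int j - int i))"
    unfolding P_conv_def by (subst rec) (simp add: sum_distrib_left)
  also have "\<dots> = (\<Sum>i = 1..k. P_conv k F m (n - int i))"
    unfolding P_conv_def by (subst sum.swap) (simp add: algebra_simps)
  finally show ?thesis .
qed

lemma periodic_kstep_eq_0:
  fixes G :: "int \<Rightarrow> int"
  assumes "k \<noteq> 1"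
    and rec: "\<And>n. G n = (\<Sum>i = 1..k. G (n - int i))"
    and periodic: "\<And>n. G (n - int k) = G n"
  shows "G n = 0"
proof -
  have step: "G (n + 1) = G n" for n
    using kstep_two_term[OF rec, of n] periodic[of n] by simp
  have "G (n - int i) = G n" for i
  proof (induction i)
    case (Suc i)
    then show ?case using step[of "n - int (Suc i)"] by simp
  qed simp
  then have "G n = int k * G n"
    by (subst rec) simp
  then show ?thesis
    using \<open>k \<noteq> 1\<close> by simp
qed

theorem theorem1p3:
  fixes k :: nat and n :: int
  assumes "k \<ge> 2"
  shows "kfib k n = (\<Sum>i = 1..k. P k i * kfib k (n - int k * int i))"
proof -
  note rec = kfib_rec[OF assms]
  have "P_conv k (kfib k) k (n - int k) = P_conv k (kfib k) k n" for n
    \<comment> \<open>For \<open>i = k\<close> the two shifts cancel.\<close>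
    using P_conv_shift_diff[OF kstep_two_term[OF rec], of k n] by simp
  then have "P_conv k (kfib k) k n = 0"
    using assms by (intro periodic_kstep_eq_0[OF _ P_conv_kstep[OF rec]]) auto
  then show ?thesis
    by (simp add: P_conv_def atMost_atLeast0 sum.atLeast_Suc_atMost)
qed

end
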